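(* Let $n,k\ge 1$, let $A=\mathbb{C}[\sigma_1,\sigma_1^{-1},\ldots,\sigma_n,\sigma_n^{-1}]$, and let $G$ be a finite subgroup of $\mathrm{Aut}_{\mathbb{C}}(A)$. Let $A=\bigoplus_{i\in\mathcal{A}_d}A_i\oplus\bigoplus_{i\in\mathcal{A}_n}A_i$ be the direct sum decomposition of the representation $A$ of $G$ corresponding to the orbits of $G$ in $A$ through the points of $\mathbb{L}=\mathbb{Z}^n$, where $\mathcal{A}_d$ indexes the degenerate orbits and $\mathcal{A}_n$ the nondegenerate ones (as defined in the context). Then $(A_i)^G$ is 1-dimensional for every $i\in\mathcal{A}_n$ and 0-dimensional for every $i\in\mathcal{A}_d$. Thus $(A^k)^G\simeq\bigoplus_{i\in\mathcal{A}_n}(A_i^k)^G$, and each $i\in\mathcal{A}_n$ contributes $k$ to the dimension of $(A^k)^G$ (i.e. $\dim (A_i^k)^G=k$). Let $P$ be a $G$-invariant $A$-submodule of $A^k$. Then the space $\ker_{\mathcal{F}}(P)^G$ of all symmetric solutions to $P$ is infinite dimensional unless $\dim_{\mathbb{C}}(A^k/P)$ is finite or there is a finite subset $I_f\subset\mathcal{A}_n$ such that the projection $\pi:A^k\to\bigoplus_{i\notin I_f}A_i^k$ satisfies $\bigoplus_{i\notin I_f}(A_i^k)^G\subset\pi(P)$, where $i\notin I_f$ ranges over $(\mathcal{A}_d\sqcup\mathcal{A}_n)\setminus I_f$.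
   Context: $\mathbb{L}=\mathbb{Z}^n$ and $\mathcal{F}=\mathbb{C}^{\mathbb{Z}^n}$ is the space of all complex-valued functions on $\mathbb{L}$. The Laurent polynomial ring $A$ acts on $\mathcal{F}$ by $(\sigma_i f)(x_1,\ldots,x_n)=f(x_1,\ldots,x_i+1,\ldots,x_n)$. $\mathrm{Aut}_{\mathbb{C}}(A)$ is the group of $\mathbb{C}$-algebra automorphisms of $A$. For an $A$-submodule $P\subset A^k$, $\ker_{\mathcal{F}}(P)=\{(f_1,\ldots,f_k)\in\mathcal{F}^k : \sum_j p_jf_j=0 \text{ for all } (p_1,\ldots,p_k)\in P\}$. Identify $x\in\mathbb{L}$ with the monomial $\sigma^x=\sigma_1^{x_1}\cdots\sigma_n^{x_n}$. These monomials form a $\mathbb{C}$-basis of $A$, so $\mathcal{F}$ is identified with $A'=\mathrm{Hom}_{\mathbb{C}}(A,\mathbb{C})$, and $\ker_{\mathcal{F}}(P)$ with $(A^k/P)'=\mathrm{Hom}_{\mathbb{C}}(A^k/P,\mathbb{C})$ via $(f_1,\ldots,f_k)\mapsto\big([(q_1,\ldots,q_k)]\mapsto\sum_j f_j(q_j)\big)$. $G$ acts on $A^k$ componentwise. $P$ is $G$-invariant if $g(P)=P$ for all $g\in G$; then $G$ acts on $A^k/P$ and on its dual by $(g\cdot f)(a)=f(g^{-1}a)$. Symmetric solutions are the elements of $\ker_{\mathcal{F}}(P)^G$, and $V^G$ denotes the fixed subspace of a representation $V$. Orbits: every $g\in\mathrm{Aut}_{\mathbb{C}}(A)$ maps each monomial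 $\sigma^x$ to a nonzero scalar multiple of a monomial. For $x\in\mathbb{L}$, let $\mathbb{A}_x$ be the $G$-orbit of $\sigma^x$ in $A$, regarded as the family $(g\sigma^x)_{g\in G}$ (elements may be repeated), and let $A_x\subset A$ be the $\mathbb{C}$-span of $\mathbb{A}_x$. The orbit is degenerate if the sum of all its elements is $0$, and nondegenerate otherwise. Two orbits $\mathbb{A}_x,\mathbb{A}_y$ whose spans coincide differ by a nonzero scalar factor and are counted as the same index. Thus $\mathcal{A}_d$ and $\mathcal{A}_n$ denote the sets of degenerate and nondegenerate orbits, one orbit being taken for each distinct span, and $A_i$ denotes the span of the orbit $i$. *)

theory Defs
  imports
    "HOL-Analysis.Cartesian_Space"
    "HOL-Library.Function_Algebras"
    "HOL-Library.Poly_Mapping"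
    "HOL-Algebra.Bij"
begin

section \<open>Linear algebra over the complex numbers\<close>

text \<open>
  Complex vector spaces are given by their scalar multiplication \<open>s\<close>, as in the locale
  \<^locale>\<open>vector_space\<close>. The library's \<open>dim\<close> is \<open>0\<close> on infinite-dimensional spaces, so
  dimension is expressed through the existence of a finite basis.
\<close>

definition has_dim :: "(complex \<Rightarrow> 'b::ab_group_add \<Rightarrow> 'b) \<Rightarrow> 'b set \<Rightarrow> nat \<Rightarrow> bool" where
  "has_dim s V d \<longleftrightarrow>
     (\<exists>B. finite B \<and> \<not> module.dependent s B \<and> module.span s B = V \<and> card B = d)"

definition finite_dim :: "(complex \<Rightarrow> 'b::ab_group_add \<Rightarrow> 'b) \<Rightarrow> 'b set \<Rightarrow> bool" where
  "finite_dim s V \<longleftrightarrow> (\<exists>d. has_dim s V d)"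

definition subspace_sum ::
    "(complex \<Rightarrow> 'b::ab_group_add \<Rightarrow> 'b) \<Rightarrow> 'i set \<Rightarrow> ('i \<Rightarrow> 'b set) \<Rightarrow> 'b set" where
  "subspace_sum s I U = module.span s (\<Union>i\<in>I. U i)"

definition internal_direct_sum ::
    "(complex \<Rightarrow> 'b::ab_group_add \<Rightarrow> 'b) \<Rightarrow> 'b set \<Rightarrow> 'i set \<Rightarrow> ('i \<Rightarrow> 'b set) \<Rightarrow> bool" where
  "internal_direct_sum s W I U \<longleftrightarrow>
     (\<forall>i\<in>I. module.subspace s (U i)) \<and>
     W = subspace_sum s I U \<and>
     (\<forall>J v. finite J \<and> J \<subseteq> I \<and> (\<forall>i\<in>J. v i \<in> U i) \<and> (\<Sum>i\<in>J. v i) = 0 \<longrightarrow> (\<forall>i\<in>J. v i = 0))"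

text \<open>
  The quotient of the ambient space by a subspace \<open>P\<close>: its elements are the cosets of \<open>P\<close>, its zero
  is \<open>P\<close>, and it carries the usual operations on cosets. It is finite-dimensional if it is the
  linear hull of finitely many cosets.
\<close>

definition coset_of :: "'b::ab_group_add set \<Rightarrow> 'b \<Rightarrow> 'b set" where
  "coset_of P a = {a + p | p. p \<in> P}"

definition quot :: "'b::ab_group_add set \<Rightarrow> 'b set set" where
  "quot P = range (coset_of P)"

definition quot_add :: "'b::ab_group_add set \<Rightarrow> 'b set \<Rightarrow> 'b set" where
  "quot_add X Y = {x + y | x y. x \<in> X \<and> y \<in> Y}"

definition quot_scale ::
    "(complex \<Rightarrow> 'b::ab_group_add \<Rightarrow> 'b) \<Rightarrow> 'b set \<Rightarrow> complex \<Rightarrow> 'b set \<Rightarrow> 'b set" where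
  "quot_scale s P c X = {s c x + p | x p. x \<in> X \<and> p \<in> P}"

definition quot_subspace ::
    "(complex \<Rightarrow> 'b::ab_group_add \<Rightarrow> 'b) \<Rightarrow> 'b set \<Rightarrow> 'b set set \<Rightarrow> bool" where
  "quot_subspace s P S \<longleftrightarrow>
     S \<subseteq> quot P \<and> P \<in> S \<and>
     (\<forall>X\<in>S. \<forall>Y\<in>S. quot_add X Y \<in> S) \<and> (\<forall>c. \<forall>X\<in>S. quot_scale s P c X \<in> S)"

definition quot_finite_dim ::
    "(complex \<Rightarrow> 'b::ab_group_add \<Rightarrow> 'b) \<Rightarrow> 'b set \<Rightarrow> bool" where
  "quot_finite_dim s P \<longleftrightarrow>
     (\<exists>C. finite C \<and> C \<subseteq> quot P \<and> quot_subspace s P hull C = quot P)"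

lemma quot_add_coset_of:
  assumes "vector_space s" "module.subspace s P"
  shows "quot_add (coset_of P a) (coset_of P b) = coset_of P (a + b)"
proof -
  interpret vector_space s by fact
  show ?thesis
  proof (intro Set.set_eqI iffI)
    fix z assume "z \<in> quot_add (coset_of P a) (coset_of P b)"
    then obtain p q where "p \<in> P" "q \<in> P" "z = (a + p) + (b + q)"
      by (auto simp: quot_add_def coset_of_def)
    then have "z = (a + b) + (p + q)" "p + q \<in> P"
      using assms(2) by (auto intro: subspace_add)
    then show "z \<in> coset_of P (a + b)" by (auto simp: coset_of_def)
  next
    fix z assume "z \<in> coset_of P (a + b)"
    then obtain p where p: "p \<in> P" "z = a + b + p" by (auto simp: coset_of_def)
    then have "z = (a + p) + (b + 0)" by simp
    then show "z \<in> quot_add (coset_of P a) (coset_of P b)"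
      using p subspace_0[OF assms(2)] unfolding quot_add_def coset_of_def by blast
  qed
qed

lemma quot_scale_coset_of:
  assumes "vector_space s" "module.subspace s P"
  shows "quot_scale s P c (coset_of P a) = coset_of P (s c a)"
proof -
  interpret vector_space s by fact
  show ?thesis
  proof (intro Set.set_eqI iffI)
    fix z assume "z \<in> quot_scale s P c (coset_of P a)"
    then obtain p q where "p \<in> P" "q \<in> P" "z = s c (a + p) + q"
      by (auto simp: quot_scale_def coset_of_def)
    then have "z = s c a + (s c p + q)" "s c p + q \<in> P"
      using assms(2) by (auto simp: scale_right_distrib intro: subspace_add subspace_scale)
    then show "z \<in> coset_of P (s c a)" by (auto simp: coset_of_def)
  next
    fix z assume "z \<in> coset_of P (s c a)"
    then obtain p where p: "p \<in> P" "z = s c a + p" by (auto simp: coset_of_def)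
    then have "z = s c (a + 0) + p" by simp
    then show "z \<in> quot_scale s P c (coset_of P a)"
      using p subspace_0[OF assms(2)] unfolding quot_scale_def coset_of_def by blast
  qed
qed

section \<open>The Laurent polynomial ring and its automorphisms\<close>

text \<open>
  The Laurent polynomial ring in variables indexed by \<open>'n\<close> is the group ring of \<open>\<int>\<^sup>n\<close>:
  finitely supported functions with convolution product. Free modules are the types
  \<open>'n laurent ^ 'k\<close>, with the scalar multiplication \<open>*s\<close> of the library.
\<close>

type_synonym 'n laurent = "(int ^ 'n) \<Rightarrow>\<^sub>0 complex"

abbreviation laurent_monom :: "int ^ 'n \<Rightarrow> 'n::finite laurent" where
  "laurent_monom x \<equiv> Poly_Mapping.single x 1"

abbreviation laurent_const :: "complex \<Rightarrow> 'n::finite laurent" where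
  "laurent_const c \<equiv> Poly_Mapping.single 0 c"

definition scale_A :: "complex \<Rightarrow> 'n::finite laurent \<Rightarrow> 'n laurent" where
  "scale_A c a = laurent_const c * a"

definition scale_Ak :: "complex \<Rightarrow> 'n::finite laurent ^ 'k \<Rightarrow> 'n laurent ^ 'k" where
  "scale_Ak c v = (\<chi> j. scale_A c (v $ j))"

definition laurent_aut :: "('n::finite laurent \<Rightarrow> 'n laurent) set" where
  "laurent_aut = {\<phi>. bij \<phi> \<and> \<phi> 1 = 1 \<and> (\<forall>a b. \<phi> (a + b) = \<phi> a + \<phi> b) \<and>
     (\<forall>a b. \<phi> (a * b) = \<phi> a * \<phi> b) \<and> (\<forall>c a. \<phi> (scale_A c a) = scale_A c (\<phi> a))}"

definition laurent_AutGroup :: "('n::finite laurent \<Rightarrow> 'n laurent) monoid" where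
  "laurent_AutGroup = BijGroup UNIV \<lparr>carrier := laurent_aut\<rparr>"

interpretation A: vector_space "scale_A :: complex \<Rightarrow> 'n::finite laurent \<Rightarrow> 'n laurent"
  by standard
     (simp_all add: scale_A_def algebra_simps single_add mult_single flip: mult.assoc)

interpretation Ak: vector_space
  "scale_Ak :: complex \<Rightarrow> 'n::finite laurent ^ 'k::finite \<Rightarrow> 'n laurent ^ 'k"
  by standard
     (simp_all add: scale_Ak_def vec_eq_iff A.scale_right_distrib A.scale_left_distrib)

interpretation laurent_module: module
  "(*s) :: 'n::finite laurent \<Rightarrow> 'n laurent ^ 'k::finite \<Rightarrow> 'n laurent ^ 'k"
  by standard (simp_all add: vec_eq_iff algebra_simps)

lemma mult_laurent_AutGroup:
  "g \<in> laurent_aut \<Longrightarrow> h \<in> laurent_aut \<Longrightarrow> g \<otimes>\<^bsub>laurent_AutGroup\<^esub> h = g \<circ> h"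
  by (auto simp: laurent_AutGroup_def BijGroup_def Bij_def laurent_aut_def compose_def bij_def
      bij_betw_def)

lemma inv_laurent_aut:
  assumes "g \<in> laurent_aut"
  shows "inv_into UNIV g \<in> laurent_aut"
proof -
  let ?h = "inv_into UNIV g"
  have b: "bij g" and one: "g 1 = 1"
    and add: "g (a + b) = g a + g b" and mul: "g (a * b) = g a * g b"
    and sc: "g (scale_A c a) = scale_A c (g a)" for a b c
    using assms by (auto simp: laurent_aut_def)
  have r: "g (?h a) = a" for a using b by (simp add: bij_is_surj surj_f_inv_f)
  have i: "a = b" if "g a = g b" for a b using b that by (simp add: bij_is_inj inj_eq)
  have "?h 1 = 1" by (rule i) (simp only: r one)
  moreover have "?h (x + y) = ?h x + ?h y" for x y by (rule i) (simp only: r add)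
  moreover have "?h (x * y) = ?h x * ?h y" for x y by (rule i) (simp only: r mul)
  moreover have "?h (scale_A c x) = scale_A c (?h x)" for c x by (rule i) (simp only: r sc)
  ultimately show ?thesis
    using bij_imp_bij_inv[OF b] unfolding laurent_aut_def by blast
qed

lemma group_laurent_AutGroup:
  "group (laurent_AutGroup :: ('n::finite laurent \<Rightarrow> 'n laurent) monoid)"
proof -
  have "subgroup (laurent_aut :: ('n laurent \<Rightarrow> 'n laurent) set) (BijGroup UNIV)"
  proof (rule subgroup.intro)
    show "laurent_aut \<subseteq> carrier (BijGroup UNIV)"
      by (auto simp: laurent_aut_def BijGroup_def Bij_def)
  next
    fix g h :: "'n laurent \<Rightarrow> 'n laurent" assume "g \<in> laurent_aut" "h \<in> laurent_aut"
    then show "g \<otimes>\<^bsub>BijGroup UNIV\<^esub> h \<in> laurent_aut"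
      by (auto simp: BijGroup_def laurent_aut_def Bij_def compose_def bij_comp[unfolded comp_def])
  next
    show "\<one>\<^bsub>BijGroup UNIV\<^esub> \<in> laurent_aut"
      by (auto simp: BijGroup_def laurent_aut_def bij_def)
  next
    fix g :: "'n laurent \<Rightarrow> 'n laurent" assume g: "g \<in> laurent_aut"
    then have "g \<in> Bij UNIV" by (simp add: laurent_aut_def Bij_def)
    from inv_BijGroup[OF this] show "inv\<^bsub>BijGroup UNIV\<^esub> g \<in> laurent_aut"
      using inv_laurent_aut[OF g] by (simp add: restrict_def)
  qed
  then show ?thesis
    unfolding laurent_AutGroup_def by (rule subgroup.subgroup_is_group[OF _ group_BijGroup])
qed

section \<open>Group actions, solutions and orbits\<close>

definition fixed_points :: "('g \<Rightarrow> 'v \<Rightarrow> 'v) \<Rightarrow> 'g set \<Rightarrow> 'v set \<Rightarrow> 'v set" where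
  "fixed_points act G V = {v \<in> V. \<forall>g\<in>G. act g v = v}"

definition act_A ::
    "('n::finite laurent \<Rightarrow> 'n laurent) \<Rightarrow> 'n laurent \<Rightarrow> 'n laurent" where
  "act_A g a = g a"

definition act_Ak ::
    "('n::finite laurent \<Rightarrow> 'n laurent) \<Rightarrow> 'n laurent ^ 'k \<Rightarrow> 'n laurent ^ 'k" where
  "act_Ak g v = (\<chi> j. g (v $ j))"

definition shift_act :: "'n::finite laurent \<Rightarrow> (int ^ 'n \<Rightarrow> complex) \<Rightarrow> int ^ 'n \<Rightarrow> complex" where
  "shift_act p f = (\<lambda>x. \<Sum>y\<in>Poly_Mapping.keys p. Poly_Mapping.lookup p y * f (x + y))"

lemma shift_act_variable: "shift_act (laurent_monom (axis i 1)) f x = f (x + axis i 1)"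
  by (simp add: shift_act_def)

definition ker_F ::
    "('n::finite laurent ^ 'k::finite) set \<Rightarrow> ((int ^ 'n \<Rightarrow> complex) ^ 'k) set" where
  "ker_F P = {f. \<forall>p\<in>P. (\<Sum>j\<in>UNIV. shift_act (p $ j) (f $ j)) = 0}"

definition scale_Fk ::
    "complex \<Rightarrow> (int ^ 'n \<Rightarrow> complex) ^ 'k \<Rightarrow> (int ^ 'n \<Rightarrow> complex) ^ 'k" where
  "scale_Fk c f = (\<chi> j. (\<lambda>x. c * (f $ j) x))"

text \<open>The linear functional on Laurent polynomials determined by its values on the monomials.\<close>

definition dual_eval :: "(int ^ 'n::finite \<Rightarrow> complex) \<Rightarrow> 'n laurent \<Rightarrow> complex" where
  "dual_eval f q = (\<Sum>x\<in>Poly_Mapping.keys q. Poly_Mapping.lookup q x * f x)"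

definition dual_pairing ::
    "(int ^ 'n::finite \<Rightarrow> complex) ^ 'k::finite \<Rightarrow> 'n laurent ^ 'k \<Rightarrow> complex" where
  "dual_pairing f q = (\<Sum>j\<in>UNIV. dual_eval (f $ j) (q $ j))"

text \<open>
  The contragredient action \<open>(g \<cdot> f)(a) = f (g\<^sup>-\<^sup>1 a)\<close>, read off on the monomials; see
  \<open>dual_pairing_act_Fk\<close> below.
\<close>

definition act_Fk ::
    "('n::finite laurent \<Rightarrow> 'n laurent) \<Rightarrow>
     (int ^ 'n \<Rightarrow> complex) ^ 'k \<Rightarrow> (int ^ 'n \<Rightarrow> complex) ^ 'k" where
  "act_Fk g f = (\<chi> j. (\<lambda>x. dual_eval (f $ j) (inv_into UNIV g (laurent_monom x))))"

interpretation Fk: vector_space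
  "scale_Fk :: complex \<Rightarrow> (int ^ 'n::finite \<Rightarrow> complex) ^ 'k::finite \<Rightarrow> _"
  by standard (simp_all add: scale_Fk_def vec_eq_iff fun_eq_iff algebra_simps)

lemma dual_eval_superset:
  "finite S \<Longrightarrow> Poly_Mapping.keys q \<subseteq> S \<Longrightarrow> dual_eval f q = (\<Sum>x\<in>S. Poly_Mapping.lookup q x * f x)"
  unfolding dual_eval_def by (rule sum.mono_neutral_left) (auto simp: in_keys_iff)

lemma dual_eval_add: "dual_eval f (p + q) = dual_eval f p + dual_eval f q"
proof -
  let ?S = "Poly_Mapping.keys p \<union> Poly_Mapping.keys q"
  have "Poly_Mapping.keys (p + q) \<subseteq> ?S" by (rule Poly_Mapping.keys_add)
  then show ?thesis
    by (simp add: dual_eval_superset[of ?S] lookup_add sum.distrib distrib_right)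
qed

lemma dual_eval_0: "dual_eval f 0 = 0"
  by (simp add: dual_eval_def)

lemma dual_eval_sum: "dual_eval f (\<Sum>i\<in>I. q i) = (\<Sum>i\<in>I. dual_eval f (q i))"
  by (induction I rule: infinite_finite_induct) (simp_all add: dual_eval_add dual_eval_0)

lemma laurent_expand:
  "q = (\<Sum>x\<in>Poly_Mapping.keys q. scale_A (Poly_Mapping.lookup q x) (laurent_monom x))"
  by (rule poly_mapping_eqI)
     (simp add: scale_A_def mult_single lookup_sum lookup_single when_def in_keys_iff)

lemma lookup_scale_A: "Poly_Mapping.lookup (scale_A c q) x = c * Poly_Mapping.lookup q x"
proof -
  have "scale_A c q = (\<Sum>y\<in>Poly_Mapping.keys q. Poly_Mapping.single y (c * Poly_Mapping.lookup q y))"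
    by (subst laurent_expand[of q])
       (simp add: scale_A_def sum_distrib_left mult_single)
  then show ?thesis
    by (simp add: lookup_sum lookup_single when_def in_keys_iff)
qed

lemma dual_eval_scale: "dual_eval f (scale_A c q) = c * dual_eval f q"
proof -
  have "Poly_Mapping.keys (scale_A c q) \<subseteq> Poly_Mapping.keys q"
    by (auto simp: in_keys_iff lookup_scale_A)
  then show ?thesis
    by (simp add: dual_eval_superset[of "Poly_Mapping.keys q"] lookup_scale_A sum_distrib_left mult.assoc)
qed

lemma dual_pairing_act_Fk:
  assumes "g \<in> laurent_aut"
  shows "dual_pairing (act_Fk g f) q = dual_pairing f (act_Ak (inv_into UNIV g) q)"
proof -
  let ?h = "inv_into UNIV g"
  have h: "?h (a + b) = ?h a + ?h b" "?h (scale_A c a) = scale_A c (?h a)" for a b c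
    using inv_laurent_aut[OF assms] by (auto simp: laurent_aut_def)
  have h0: "?h 0 = 0" using h(1)[of 0 0] by simp
  have hs: "?h (\<Sum>i\<in>I. r i) = (\<Sum>i\<in>I. ?h (r i))" for I :: "(int^'a) set" and r
    by (induction I rule: infinite_finite_induct) (simp_all add: h h0)
  have "dual_eval (\<lambda>x. dual_eval u (?h (laurent_monom x))) r = dual_eval u (?h r)" for u r
  proof -
    have "?h r = (\<Sum>x\<in>Poly_Mapping.keys r.
        scale_A (Poly_Mapping.lookup r x) (?h (laurent_monom x)))"
      by (subst laurent_expand[of r]) (simp only: hs h)
    then have "dual_eval u (?h r) = (\<Sum>x\<in>Poly_Mapping.keys r.
        Poly_Mapping.lookup r x * dual_eval u (?h (laurent_monom x)))"
      by (simp only: dual_eval_sum dual_eval_scale)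
    then show ?thesis by (simp only: dual_eval_def[of "\<lambda>x. dual_eval u (?h (laurent_monom x))"])
  qed
  then show ?thesis
    by (simp add: dual_pairing_def act_Fk_def act_Ak_def)
qed

text \<open>
  For a submodule \<open>P\<close> the solution space is the annihilator of \<open>P\<close>, that is, the dual of the
  quotient by \<open>P\<close>.
\<close>

lemma shift_act_eq: "shift_act p f x = dual_eval f (laurent_monom x * p)"
proof -
  have "laurent_monom x * p =
      (\<Sum>y\<in>Poly_Mapping.keys p. scale_A (Poly_Mapping.lookup p y) (laurent_monom (x + y)))"
    by (subst laurent_expand[of p])
       (simp add: scale_A_def sum_distrib_left mult_single)
  then have "dual_eval f (laurent_monom x * p) =
      (\<Sum>y\<in>Poly_Mapping.keys p. Poly_Mapping.lookup p y * dual_eval f (laurent_monom (x + y)))"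
    by (simp only: dual_eval_sum dual_eval_scale)
  then show ?thesis by (simp add: shift_act_def dual_eval_def)
qed

lemma sum_shift_act_eq:
  "(\<Sum>j\<in>UNIV. shift_act (p $ j) (f $ j)) x = dual_pairing f (laurent_monom x *s p)"
proof -
  have "(\<Sum>j\<in>J. shift_act (p $ j) (f $ j)) x = (\<Sum>j\<in>J. shift_act (p $ j) (f $ j) x)" for J
    by (induction J rule: infinite_finite_induct) simp_all
  then show ?thesis by (simp add: dual_pairing_def shift_act_eq)
qed

lemma ker_F_eq_annihilator:
  assumes "module.subspace (*s) P"
  shows "ker_F P = {f. \<forall>q\<in>P. dual_pairing f q = 0}"
proof (intro Set.set_eqI iffI)
  fix f assume "f \<in> ker_F P"
  then have "dual_pairing f (laurent_monom 0 *s q) = 0" if "q \<in> P" for q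
    using that sum_shift_act_eq[of q f 0] by (simp add: ker_F_def)
  then show "f \<in> {f. \<forall>q\<in>P. dual_pairing f q = 0}" by simp
next
  fix f assume "f \<in> {f. \<forall>q\<in>P. dual_pairing f q = 0}"
  moreover have "laurent_monom x *s p \<in> P" if "p \<in> P" for x p
    using laurent_module.subspace_scale[OF assms that] .
  ultimately show "f \<in> ker_F P"
    by (auto simp: ker_F_def fun_eq_iff sum_shift_act_eq)
qed

text \<open>
  \<open>orbit_span G x\<close> is the span of the orbit of the monomial with exponent \<open>x\<close>. The sum in
  \<open>degenerate_orbit\<close> runs over the group, so repeated orbit elements are counted repeatedly.
  Orbits are indexed by their spans: the index sets below are sets of subspaces, and the space
  \<open>A\<^sub>i\<close> belonging to the index \<open>i\<close> is \<open>i\<close> itself.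
\<close>

definition orbit_span ::
    "('n::finite laurent \<Rightarrow> 'n laurent) set \<Rightarrow> int ^ 'n \<Rightarrow> 'n laurent set" where
  "orbit_span G x = module.span scale_A ((\<lambda>g. g (laurent_monom x)) ` G)"

definition degenerate_orbit ::
    "('n::finite laurent \<Rightarrow> 'n laurent) set \<Rightarrow> int ^ 'n \<Rightarrow> bool" where
  "degenerate_orbit G x \<longleftrightarrow> (\<Sum>g\<in>G. g (laurent_monom x)) = 0"

definition degenerate_orbits ::
    "('n::finite laurent \<Rightarrow> 'n laurent) set \<Rightarrow> 'n laurent set set" where
  "degenerate_orbits G = {orbit_span G x | x. degenerate_orbit G x}"

definition nondegenerate_orbits ::
    "('n::finite laurent \<Rightarrow> 'n laurent) set \<Rightarrow> 'n laurent set set" where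
  "nondegenerate_orbits G = {orbit_span G x | x. \<not> degenerate_orbit G x}"

definition pow_k :: "'n::finite laurent set \<Rightarrow> ('n laurent ^ 'k) set" where
  "pow_k V = {v. \<forall>j. v $ j \<in> V}"

text \<open>
  The projection of the free module onto the sum of the \<open>A\<^sub>i\<^sup>k\<close> with \<open>i \<notin> I\<close>, along
  the sum of those with \<open>i \<in> I\<close>. As the free module is the direct sum of all \<open>A\<^sub>i\<^sup>k\<close>, there is
  exactly one such map.
\<close>

definition orbit_projection ::
    "('n::finite laurent \<Rightarrow> 'n laurent) set \<Rightarrow> 'n laurent set set \<Rightarrow>
     ('n laurent ^ 'k::finite \<Rightarrow> 'n laurent ^ 'k) \<Rightarrow> bool" where
  "orbit_projection G I \<pi> \<longleftrightarrow>
     Vector_Spaces.linear scale_Ak scale_Ak \<pi> \<and>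
     (\<forall>i\<in>degenerate_orbits G \<union> nondegenerate_orbits G. \<forall>v\<in>pow_k i.
        \<pi> v = (if i \<in> I then 0 else v))"

end

theory Submission
  imports Defs "HOL-Computational_Algebra.Polynomial"
begin

text \<open>
  Units of the Laurent polynomial ring are scalar multiples of monomials: an additive functional
  separating the supports of two mutually inverse elements attains its extrema on each support at a
  single monomial. Hence \<open>G\<close> permutes the monomials up to scalars, and everything about orbits can be
  read off from supports.

  If the space of symmetric solutions is finite-dimensional, then so is its predual, the quotient of
  \<open>A\<^sup>k\<close> by \<open>Q = {q. \<Sum>g\<in>G. g q \<in> P}\<close>. Averaging representatives of this quotient shows that the
  fixed vectors of \<open>A\<^sup>k\<close> are spanned, modulo \<open>P\<close>, by finitely many fixed vectors; these
  only involve finitely many orbits, all of them nondegenerate, and projecting those orbits away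
  leaves fixed vectors that come from \<open>P\<close>.
\<close>

section \<open>Units of the Laurent polynomial ring\<close>

text \<open>Read a vector as an integer polynomial with the coordinates as coefficients and evaluate
  at an integer \<open>t\<close>. Two distinct points of \<open>K\<close> get the same value only if
  \<open>t\<close> is a root of their nonzero difference polynomial; finitely many differences have
  finitely many roots, so some \<open>t\<close> avoids them all.\<close>

lemma additive_functional_inj_on_finite:
  fixes K :: "(int ^ 'n::finite) set"
  assumes "finite K"
  shows "\<exists>\<phi> :: int ^ 'n \<Rightarrow> int. (\<forall>x y. \<phi> (x + y) = \<phi> x + \<phi> y) \<and> inj_on \<phi> K"
proof -
  obtain e :: "'n \<Rightarrow> nat" where e: "inj e"
    using finite_imp_inj_to_nat_seg[of "UNIV :: 'n set"] by auto
  define p :: "int ^ 'n \<Rightarrow> int poly" where "p x = (\<Sum>i\<in>UNIV. monom (x $ i) (e i))" for x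
  have coeff: "coeff (p x) (e i) = x $ i" for x i
    using e by (simp add: p_def coeff_sum inj_eq)
  have add: "p (x + y) = p x + p y" for x y
    by (simp add: p_def sum.distrib flip: add_monom)
  define D where "D = (\<lambda>(x, y). p x - p y) ` (K \<times> K) - {0}"
  have "finite D" "\<And>d. d \<in> D \<Longrightarrow> d \<noteq> 0" using assms by (auto simp: D_def)
  then have "finite (\<Union>d\<in>D. {t. poly d t = 0})" by (auto simp: poly_roots_finite)
  then obtain t where t: "t \<notin> (\<Union>d\<in>D. {t. poly d t = 0})"
    using ex_new_if_finite infinite_UNIV_int by blast
  show ?thesis
  proof (intro exI conjI allI)
    show "poly (p (x + y)) t = poly (p x) t + poly (p y) t" for x y
      by (simp add: add)
    show "inj_on (\<lambda>x. poly (p x) t) K"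
    proof (rule inj_onI, rule ccontr)
      fix x y assume xy: "x \<in> K" "y \<in> K" "poly (p x) t = poly (p y) t" "x \<noteq> y"
      then have "p x \<noteq> p y" by (metis coeff vec_eq_iff)
      then have "p x - p y \<in> D" using xy by (auto simp: D_def)
      then show False using t xy by auto
    qed
  qed
qed

text \<open>Once \<open>x = x0\<close> is forced, cancellation forces \<open>y = y0\<close>, so a
  single pair of exponents contributes to this coefficient and nothing can cancel.\<close>

lemma lookup_mult_unique:
  fixes a b :: "'n::finite laurent"
  assumes "x0 \<in> Poly_Mapping.keys a" "y0 \<in> Poly_Mapping.keys b"
    and "\<And>x y. x \<in> Poly_Mapping.keys a \<Longrightarrow> y \<in> Poly_Mapping.keys b \<Longrightarrow> x + y = x0 + y0 \<Longrightarrow> x = x0"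
  shows "Poly_Mapping.lookup (a * b) (x0 + y0) = Poly_Mapping.lookup a x0 * Poly_Mapping.lookup b y0"
proof -
  let ?a = "Poly_Mapping.lookup a" and ?b = "Poly_Mapping.lookup b"
  have "a * b = (\<Sum>x\<in>Poly_Mapping.keys a. Poly_Mapping.single x (?a x)) *
      (\<Sum>y\<in>Poly_Mapping.keys b. Poly_Mapping.single y (?b y))"
    using laurent_expand[of a] laurent_expand[of b] by (simp add: scale_A_def mult_single)
  then have "a * b = (\<Sum>x\<in>Poly_Mapping.keys a. \<Sum>y\<in>Poly_Mapping.keys b.
      Poly_Mapping.single (x + y) (?a x * ?b y))"
    by (simp only: sum_product mult_single)
  then have "Poly_Mapping.lookup (a * b) (x0 + y0) =
      (\<Sum>x\<in>Poly_Mapping.keys a. \<Sum>y\<in>Poly_Mapping.keys b.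
        if x = x0 \<and> y = y0 then ?a x * ?b y else 0)"
    using assms(3) by (fastforce simp: lookup_sum lookup_single when_def intro!: sum.cong)
  also have "\<dots> = (\<Sum>x\<in>Poly_Mapping.keys a. if x = x0 then ?a x * ?b y0 else 0)"
    using assms(2) by (intro sum.cong refl) (auto simp: sum.delta)
  finally show ?thesis using assms(1) by simp
qed

text \<open>The products of the extreme terms survive in \<open>a * b = 1\<close>, so the two
  maximal exponents add up to \<open>0\<close>, and so do the two minimal ones. Hence \<phi> is
  constant on the support of \<open>a\<close>, which injectivity shrinks to a point.\<close>

lemma laurent_unit_single:
  fixes a b :: "'n::finite laurent"
  assumes "a * b = 1"
  shows "\<exists>x c. c \<noteq> 0 \<and> a = Poly_Mapping.single x c"
proof -
  let ?K = "Poly_Mapping.keys"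
  obtain \<phi> :: "int ^ 'n \<Rightarrow> int"
    where add: "\<And>x y. \<phi> (x + y) = \<phi> x + \<phi> y" and inj: "inj_on \<phi> (?K a \<union> ?K b)"
    using additive_functional_inj_on_finite[of "?K a \<union> ?K b"] by (metis finite_Un finite_keys)
  have "a \<noteq> 0" "b \<noteq> 0" using assms by auto
  then have ne: "?K a \<noteq> {}" "?K b \<noteq> {}" by auto
  \<comment> \<open>The condition \<open>ext\<close> is phrased in values of \<phi> only, so that
    the maximal and the minimal pair can both be fed into it.\<close>
  have sum0: "x + y = 0"
    if "x \<in> ?K a" "y \<in> ?K b" and ext:
      "\<And>x' y'. x' \<in> ?K a \<Longrightarrow> y' \<in> ?K b \<Longrightarrow> \<phi> x' + \<phi> y' = \<phi> x + \<phi> y \<Longrightarrow> \<phi> x' = \<phi> x" for x y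
  proof -
    have "x' = x" if "x' \<in> ?K a" "y' \<in> ?K b" "x' + y' = x + y" for x' y'
    proof -
      have "\<phi> x' + \<phi> y' = \<phi> x + \<phi> y" using that(3) by (simp flip: add)
      then have "\<phi> x' = \<phi> x" using ext that by blast
      then show ?thesis using inj that(1) \<open>x \<in> ?K a\<close> by (auto dest: inj_onD)
    qed
    then have "Poly_Mapping.lookup (a * b) (x + y) =
        Poly_Mapping.lookup a x * Poly_Mapping.lookup b y"
      using that(1,2) by (intro lookup_mult_unique)
    then have "Poly_Mapping.lookup (a * b) (x + y) \<noteq> 0"
      using that(1,2) by (simp add: in_keys_iff)
    then show ?thesis using assms by (auto simp: lookup_one when_def split: if_splits)
  qed
  \<comment> \<open>Minimising \<open>- \<phi>\<close> yields a maximum: index 1 marks the maxima,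
    index 2 the minima.\<close>
  define x1 where "x1 = arg_min_on (\<lambda>x. - \<phi> x) (?K a)"
  define y1 where "y1 = arg_min_on (\<lambda>x. - \<phi> x) (?K b)"
  define x2 where "x2 = arg_min_on \<phi> (?K a)"
  define y2 where "y2 = arg_min_on \<phi> (?K b)"
  have in_keys: "x1 \<in> ?K a" "y1 \<in> ?K b" "x2 \<in> ?K a" "y2 \<in> ?K b"
    unfolding x1_def y1_def x2_def y2_def using ne by (auto intro!: arg_min_if_finite)
  have x1: "\<phi> x \<le> \<phi> x1" and x2: "\<phi> x2 \<le> \<phi> x" if "x \<in> ?K a" for x
    using arg_min_least[OF finite_keys ne(1) that, of "\<lambda>x. - \<phi> x"]
      arg_min_least[OF finite_keys ne(1) that, of \<phi>] by (simp_all add: x1_def x2_def)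
  have y1: "\<phi> y \<le> \<phi> y1" and y2: "\<phi> y2 \<le> \<phi> y" if "y \<in> ?K b" for y
    using arg_min_least[OF finite_keys ne(2) that, of "\<lambda>x. - \<phi> x"]
      arg_min_least[OF finite_keys ne(2) that, of \<phi>] by (simp_all add: y1_def y2_def)
  have "\<phi> x = \<phi> x1" if "x \<in> ?K a" "y \<in> ?K b" "\<phi> x + \<phi> y = \<phi> x1 + \<phi> y1" for x y
    using x1[OF that(1)] y1[OF that(2)] that(3) by linarith
  then have "x1 + y1 = 0" by (rule sum0[OF in_keys(1,2)])
  moreover have "\<phi> x = \<phi> x2" if "x \<in> ?K a" "y \<in> ?K b" "\<phi> x + \<phi> y = \<phi> x2 + \<phi> y2" for x y
    using x2[OF that(1)] y2[OF that(2)] that(3) by linarith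
  then have "x2 + y2 = 0" by (rule sum0[OF in_keys(3,4)])
  ultimately have "\<phi> x1 + \<phi> y1 = \<phi> x2 + \<phi> y2" by (simp flip: add)
  \<comment> \<open>The differences \<open>\<phi> x1 - \<phi> x2\<close> and
    \<open>\<phi> y1 - \<phi> y2\<close> are nonnegative and add up to \<open>0\<close>, so both
    vanish.\<close>
  then have "\<phi> x1 = \<phi> x2"
    using x1[OF in_keys(3)] y1[OF in_keys(4)] by simp
  then have "\<phi> x = \<phi> x1" if "x \<in> ?K a" for x
    using x1[OF that] x2[OF that] by simp
  then have "x = x1" if "x \<in> ?K a" for x
    using inj that in_keys(1) by (auto dest: inj_onD)
  then have "a = Poly_Mapping.single x1 (Poly_Mapping.lookup a x1)"
    by (intro poly_mapping_eqI) (auto simp: lookup_single when_def in_keys_iff)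
  moreover have "Poly_Mapping.lookup a x1 \<noteq> 0" using in_keys(1) by (simp add: in_keys_iff)
  ultimately show ?thesis by blast
qed

text \<open>Monomials are units and automorphisms preserve units; the image of the monomial with
  exponent \<open>- x\<close> is the inverse.\<close>

lemma laurent_aut_monom:
  fixes x :: "int ^ 'n::finite"
  assumes "g \<in> laurent_aut"
  shows "\<exists>y c. c \<noteq> 0 \<and> g (laurent_monom x) = Poly_Mapping.single y c"
proof -
  have "g (laurent_monom x) * g (laurent_monom (- x)) = g (laurent_monom x * laurent_monom (- x))"
    using assms by (simp add: laurent_aut_def)
  also have "\<dots> = 1" using assms by (simp add: mult_single laurent_aut_def)
  finally show ?thesis by (rule laurent_unit_single)
qed

lemma single_eq_scale_A: "Poly_Mapping.single y c = scale_A c (laurent_monom y)"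
  by (simp add: scale_A_def mult_single)

text \<open>Translates spans of monomials into conditions on supports, so that orbit spans can be
  compared as sets of exponents.\<close>

lemma span_laurent_monom:
  fixes S :: "(int ^ 'n::finite) set"
  shows "A.span (laurent_monom ` S) = {a. Poly_Mapping.keys a \<subseteq> S}"
proof (intro subset_antisym subsetI CollectI)
  fix a :: "'n laurent" and y assume "a \<in> A.span (laurent_monom ` S)" and y: "y \<in> Poly_Mapping.keys a"
  from this(1) have "y \<notin> S \<longrightarrow> Poly_Mapping.lookup a y = 0"
    by (induction rule: A.span_induct_alt)
       (auto simp: lookup_add lookup_scale_A lookup_single)
  then show "y \<in> S" using y by (auto simp: in_keys_iff)
next
  fix a :: "'n laurent" assume "a \<in> {a. Poly_Mapping.keys a \<subseteq> S}"
  then show "a \<in> A.span (laurent_monom ` S)"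
    by (subst laurent_expand[of a]) (blast intro: A.span_sum A.span_scale A.span_base)
qed

section \<open>The orbit decomposition\<close>

lemma keys_scale_A: "c \<noteq> 0 \<Longrightarrow> Poly_Mapping.keys (scale_A c a) = Poly_Mapping.keys a"
  by (auto simp: in_keys_iff lookup_scale_A)

lemma scale_Ak_nth: "scale_Ak c v $ j = scale_A c (v $ j)"
  by (simp add: scale_Ak_def)

lemma laurent_vec_expand:
  fixes q :: "'n::finite laurent ^ 'k::finite"
  shows "q = (\<Sum>j\<in>UNIV. \<Sum>x\<in>Poly_Mapping.keys (q $ j).
    scale_Ak (Poly_Mapping.lookup (q $ j) x) (axis j (laurent_monom x)))"
proof -
  have "(\<Sum>j\<in>UNIV. (\<Sum>x\<in>Poly_Mapping.keys (q $ j).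
      scale_Ak (Poly_Mapping.lookup (q $ j) x) (axis j (laurent_monom x))) $ i) = q $ i" for i
  proof -
    have "(\<Sum>x\<in>Poly_Mapping.keys (q $ j).
        scale_Ak (Poly_Mapping.lookup (q $ j) x) (axis j (laurent_monom x))) $ i =
        (if j = i then q $ i else 0)" for j
      using laurent_expand[of "q $ i"] by (simp add: scale_Ak_nth axis_def)
    then show ?thesis by simp
  qed
  then show ?thesis by (simp add: vec_eq_iff)
qed

lemma one_laurent_AutGroup: "\<one>\<^bsub>laurent_AutGroup\<^esub> = (id :: 'n::finite laurent \<Rightarrow> 'n laurent)"
  by (auto simp: laurent_AutGroup_def BijGroup_def)

section \<open>Finite automorphism groups and their orbits on exponents\<close>

locale finite_laurent_group =
  fixes G :: "('n::finite laurent \<Rightarrow> 'n laurent) set"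
  assumes subgroup_G: "subgroup G laurent_AutGroup" and finite_G: "finite G"
begin

lemma aut: "g \<in> G \<Longrightarrow> g \<in> laurent_aut"
  using subgroup.subset[OF subgroup_G] by (auto simp: laurent_AutGroup_def)

lemma comp_in: "g \<in> G \<Longrightarrow> h \<in> G \<Longrightarrow> g \<circ> h \<in> G"
  using subgroup.m_closed[OF subgroup_G] mult_laurent_AutGroup aut by metis

lemma id_in: "id \<in> G"
  using subgroup.one_closed[OF subgroup_G] by (simp add: one_laurent_AutGroup)

text \<open>Subgroups are closed under the inverse of the group structure, while the dual action
  uses \<open>inv_into\<close>. Both are two-sided inverses under composition, hence equal.\<close>

lemma inv_in:
  assumes "g \<in> G"
  shows "inv_into UNIV g \<in> G"
proof -
  interpret AG: group "laurent_AutGroup :: ('n laurent \<Rightarrow> 'n laurent) monoid"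
    by (rule group_laurent_AutGroup)
  let ?h = "inv\<^bsub>laurent_AutGroup\<^esub> g"
  have h: "?h \<in> G" using subgroup.m_inv_closed[OF subgroup_G assms] .
  have "g \<in> carrier laurent_AutGroup" using subgroup.subset[OF subgroup_G] assms by auto
  then have "g \<circ> ?h = id" "?h \<circ> g = id"
    using AG.r_inv[of g] AG.l_inv[of g] mult_laurent_AutGroup aut[OF h] aut[OF assms]
    by (metis one_laurent_AutGroup)+
  then have "inv_into UNIV g = ?h" by (rule inv_unique_comp)
  then show ?thesis using h by simp
qed

lemma inv_apply:
  assumes "g \<in> G"
  shows "g (inv_into UNIV g a) = a" "inv_into UNIV g (g a) = a"
proof -
  have "bij g" using aut[OF assms] by (simp add: laurent_aut_def)
  then show "g (inv_into UNIV g a) = a" "inv_into UNIV g (g a) = a"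
    by (simp_all add: bij_is_surj surj_f_inv_f bij_is_inj)
qed

lemma map_add: "g \<in> G \<Longrightarrow> g (a + b) = g a + g b"
  using aut by (simp add: laurent_aut_def)

lemma map_scale: "g \<in> G \<Longrightarrow> g (scale_A c a) = scale_A c (g a)"
  using aut by (simp add: laurent_aut_def)

lemma map_0: "g \<in> G \<Longrightarrow> g 0 = 0"
  using map_add[of g 0 0] by simp

lemma map_sum: "g \<in> G \<Longrightarrow> g (\<Sum>i\<in>I. r i) = (\<Sum>i\<in>I. g (r i))"
  by (induction I rule: infinite_finite_induct) (simp_all add: map_add map_0)

lemma map_expand:
  "g \<in> G \<Longrightarrow> g a = (\<Sum>x\<in>Poly_Mapping.keys a. scale_A (Poly_Mapping.lookup a x) (g (laurent_monom x)))"
  by (subst laurent_expand[of a]) (simp only: map_sum map_scale)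

text \<open>The orbit of the exponent \<open>x\<close> under the induced permutation action on
  exponents, with the scalars forgotten. Each set in the union is a singleton by
  \<open>laurent_aut_monom\<close>.\<close>

definition orbit_exps :: "int ^ 'n \<Rightarrow> (int ^ 'n) set" where
  "orbit_exps x = (\<Union>g\<in>G. Poly_Mapping.keys (g (laurent_monom x)))"

lemma map_monom:
  assumes "g \<in> G" "y \<in> Poly_Mapping.keys (g (laurent_monom x))"
  obtains c where "c \<noteq> 0" "g (laurent_monom x) = scale_A c (laurent_monom y)"
proof -
  obtain z c where c: "c \<noteq> 0" "g (laurent_monom x) = Poly_Mapping.single z c"
    using laurent_aut_monom[OF aut[OF assms(1)], of x] by blast
  then have "z = y" using assms(2) by simp
  then show ?thesis using c that single_eq_scale_A[of y c] by simp
qed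

lemma orbit_expsE:
  assumes "y \<in> orbit_exps x"
  obtains g c where "g \<in> G" "c \<noteq> 0" "g (laurent_monom x) = scale_A c (laurent_monom y)"
proof -
  obtain g where g: "g \<in> G" "y \<in> Poly_Mapping.keys (g (laurent_monom x))"
    using assms by (auto simp: orbit_exps_def)
  from g show ?thesis by (rule map_monom) (rule that[OF g(1)])
qed

lemma orbit_expsI:
  assumes "g \<in> G" "c \<noteq> 0" "g (laurent_monom x) = scale_A c (laurent_monom y)"
  shows "y \<in> orbit_exps x"
  using assms by (auto simp: orbit_exps_def keys_scale_A intro!: bexI[of _ g])

lemma orbit_exps_refl: "x \<in> orbit_exps x"
  by (rule orbit_expsI[OF id_in, of 1]) auto

lemma orbit_exps_sym: "y \<in> orbit_exps x \<Longrightarrow> x \<in> orbit_exps y"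
proof (elim orbit_expsE)
  fix g c assume g: "g \<in> G" "c \<noteq> 0" "g (laurent_monom x) = scale_A c (laurent_monom y)"
  \<comment> \<open>The scalar is first completed to \<open>c\<close>, so that the inverse of
    \<open>g\<close> meets an actual value of \<open>g\<close>; this leaves the factor
    \<open>1 / c\<close>.\<close>
  have "inv_into UNIV g (laurent_monom y) =
      scale_A (1 / c) (inv_into UNIV g (scale_A c (laurent_monom y)))"
    using g(2) by (simp add: map_scale[OF inv_in[OF g(1)]])
  also have "\<dots> = scale_A (1 / c) (laurent_monom x)"
    by (simp add: inv_apply[OF g(1)] flip: g(3))
  finally show ?thesis using g(2) by (intro orbit_expsI[OF inv_in[OF g(1)], of "1 / c"]) auto
qed

lemma orbit_exps_trans: "y \<in> orbit_exps x \<Longrightarrow> z \<in> orbit_exps y \<Longrightarrow> z \<in> orbit_exps x"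
proof (elim orbit_expsE)
  fix g h c d
  assume g: "g \<in> G" "c \<noteq> 0" "g (laurent_monom x) = scale_A c (laurent_monom y)"
    and h: "h \<in> G" "d \<noteq> 0" "h (laurent_monom y) = scale_A d (laurent_monom z)"
  then show ?thesis
    by (intro orbit_expsI[OF comp_in[OF h(1) g(1)], of "c * d"]) (auto simp: map_scale)
qed

lemma orbit_exps_eq: "y \<in> orbit_exps x \<Longrightarrow> orbit_exps y = orbit_exps x"
  using orbit_exps_sym orbit_exps_trans by blast

text \<open>Up to nonzero scalars the orbit consists exactly of the monomials with exponents in
  \<open>orbit_exps x\<close>, so both families have the same span.\<close>

lemma orbit_span_eq: "orbit_span G x = {a. Poly_Mapping.keys a \<subseteq> orbit_exps x}"
proof -
  have "A.span ((\<lambda>g. g (laurent_monom x)) ` G) = A.span (laurent_monom ` orbit_exps x)"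
  proof (intro subset_antisym A.span_minimal A.subspace_span subsetI)
    fix a assume "a \<in> (\<lambda>g. g (laurent_monom x)) ` G"
    then show "a \<in> A.span (laurent_monom ` orbit_exps x)"
      by (auto simp: span_laurent_monom orbit_exps_def)
  next
    fix a :: "'n laurent" assume "a \<in> laurent_monom ` orbit_exps x"
    then obtain y where a: "a = laurent_monom y" "y \<in> orbit_exps x" by auto
    from a(2) obtain g c
      where g: "g \<in> G" "c \<noteq> 0" "g (laurent_monom x) = scale_A c (laurent_monom y)"
      by (rule orbit_expsE)
    have "scale_A (1 / c) (g (laurent_monom x)) \<in> A.span ((\<lambda>g. g (laurent_monom x)) ` G)"
      using g(1) by (intro A.span_scale A.span_base) auto
    then show "a \<in> A.span ((\<lambda>g. g (laurent_monom x)) ` G)"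
      using g(2,3) a(1) by simp
  qed
  then show ?thesis by (simp add: orbit_span_def span_laurent_monom)
qed

text \<open>Indices thus correspond to classes of exponents, and any exponent in the support of an
  element of an index space determines that index.\<close>

lemma orbit_span_eq_iff: "orbit_span G x = orbit_span G y \<longleftrightarrow> y \<in> orbit_exps x"
proof
  assume "orbit_span G x = orbit_span G y"
  moreover have "laurent_monom y \<in> orbit_span G y" by (simp add: orbit_span_eq orbit_exps_refl)
  ultimately have "laurent_monom y \<in> orbit_span G x" by simp
  then show "y \<in> orbit_exps x" by (simp add: orbit_span_eq)
qed (simp add: orbit_span_eq orbit_exps_eq)

lemma orbit_indices: "degenerate_orbits G \<union> nondegenerate_orbits G = range (orbit_span G)"
  by (auto simp: degenerate_orbits_def nondegenerate_orbits_def)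

lemma key_orbit_span: "a \<in> orbit_span G x \<Longrightarrow> y \<in> Poly_Mapping.keys a \<Longrightarrow> orbit_span G y = orbit_span G x"
  using orbit_span_eq_iff[of x y] by (auto simp: orbit_span_eq)

lemma map_in_orbit_span:
  assumes "g \<in> G" "a \<in> orbit_span G x"
  shows "g a \<in> orbit_span G x"
proof -
  have "g (laurent_monom y) \<in> orbit_span G x" if "y \<in> Poly_Mapping.keys a" for y
    using key_orbit_span[OF assms(2) that] assms(1)
    by (auto simp: orbit_span_def intro: A.span_base)
  then show ?thesis
    unfolding map_expand[OF assms(1), of a]
    by (auto simp: orbit_span_def intro!: A.span_sum A.span_scale)
qed

lemma image_orbit_span:
  assumes "g \<in> G"
  shows "g ` orbit_span G x = orbit_span G x"
proof (intro subset_antisym subsetI)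
  fix a assume "a \<in> orbit_span G x"
  then have "inv_into UNIV g a \<in> orbit_span G x" by (rule map_in_orbit_span[OF inv_in[OF assms]])
  then show "a \<in> g ` orbit_span G x" by (metis image_eqI inv_apply(1)[OF assms])
qed (auto intro: map_in_orbit_span assms)

text \<open>Different index spaces have disjoint supports, so the coefficient of the sum at an
  exponent of \<open>v i\<close> comes from \<open>v i\<close> alone.\<close>

lemma orbit_components_independent:
  assumes "finite J" "J \<subseteq> range (orbit_span G)" "\<And>i. i \<in> J \<Longrightarrow> v i \<in> i" "(\<Sum>i\<in>J. v i) = 0" "i \<in> J"
  shows "v i = 0"
proof (rule ccontr)
  assume "v i \<noteq> 0"
  then obtain y where y: "y \<in> Poly_Mapping.keys (v i)" by (metis ex_in_conv keys_eq_empty)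
  have eq: "j = orbit_span G y" if "j \<in> J" "y \<in> Poly_Mapping.keys (v j)" for j
    using assms(2) assms(3)[OF that(1)] that key_orbit_span by blast
  have "0 = (\<Sum>j\<in>J. Poly_Mapping.lookup (v j) y)"
    using assms(4) by (metis lookup_sum lookup_zero)
  also have "\<dots> = (\<Sum>j\<in>{i}. Poly_Mapping.lookup (v j) y)"
    using assms(1,5) eq eq[OF assms(5) y]
    by (intro sum.mono_neutral_right) (auto simp: in_keys_iff)
  finally show False using y by (simp add: in_keys_iff)
qed

lemma direct_sum_orbits:
  "internal_direct_sum scale_A UNIV (degenerate_orbits G \<union> nondegenerate_orbits G) (\<lambda>i. i)"
  unfolding internal_direct_sum_def orbit_indices
proof (intro conjI ballI allI impI)
  fix i assume "i \<in> range (orbit_span G)"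
  then show "A.subspace i" by (auto simp: orbit_span_def)
next
  have "a \<in> A.span (\<Union> (range (orbit_span G)))" for a :: "'n laurent"
  proof -
    have "laurent_monom x \<in> A.span (\<Union> (range (orbit_span G)))" for x
      by (rule A.span_base) (auto simp: orbit_span_eq orbit_exps_refl intro!: exI[of _ x])
    then show ?thesis by (subst laurent_expand[of a]) (intro A.span_sum A.span_scale)
  qed
  then show "UNIV = subspace_sum scale_A (range (orbit_span G)) (\<lambda>i. i)"
    by (auto simp: subspace_sum_def)
next
  fix J and v :: "'n laurent set \<Rightarrow> 'n laurent" and i
  assume "finite J \<and> J \<subseteq> range (orbit_span G) \<and> (\<forall>i\<in>J. v i \<in> i) \<and> (\<Sum>i\<in>J. v i) = 0" "i \<in> J"
  then show "v i = 0" using orbit_components_independent[of J v i] by blast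
qed

section \<open>Averaging over the group\<close>

text \<open>The Reynolds operator without its factor \<open>1 / card G\<close>. In this form its
  value at a monomial is the very sum that decides degeneracy.\<close>

definition reynolds :: "'n laurent \<Rightarrow> 'n laurent" where
  "reynolds a = (\<Sum>g\<in>G. g a)"

lemma reynolds_0: "reynolds 0 = 0"
  by (simp add: reynolds_def map_0)

lemma reynolds_add: "reynolds (a + b) = reynolds a + reynolds b"
  by (simp add: reynolds_def map_add sum.distrib)

lemma reynolds_scale: "reynolds (scale_A c a) = scale_A c (reynolds a)"
  by (simp add: reynolds_def map_scale A.scale_sum_right)

lemma reynolds_expand:
  "reynolds a =
    (\<Sum>x\<in>Poly_Mapping.keys a. scale_A (Poly_Mapping.lookup a x) (reynolds (laurent_monom x)))"
proof -
  have "reynolds a = (\<Sum>g\<in>G. \<Sum>x\<in>Poly_Mapping.keys a.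
      scale_A (Poly_Mapping.lookup a x) (g (laurent_monom x)))"
    unfolding reynolds_def using map_expand by (intro sum.cong) auto
  also have "\<dots> = (\<Sum>x\<in>Poly_Mapping.keys a. \<Sum>g\<in>G.
      scale_A (Poly_Mapping.lookup a x) (g (laurent_monom x)))"
    by (rule sum.swap)
  finally show ?thesis by (simp add: reynolds_def A.scale_sum_right)
qed

lemma map_reynolds:
  assumes "h \<in> G"
  shows "h (reynolds a) = reynolds a"
proof -
  have "h (reynolds a) = (\<Sum>g\<in>G. (h \<circ> g) a)" by (simp add: reynolds_def map_sum[OF assms])
  also have "\<dots> = (\<Sum>g\<in>G. g a)"
    by (rule sum.reindex_bij_witness[of _ "\<lambda>g. inv_into UNIV h \<circ> g" "\<lambda>g. h \<circ> g"])
       (auto simp: comp_in inv_in assms inv_apply[OF assms] fun_eq_iff)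
  finally show ?thesis by (simp add: reynolds_def)
qed

lemma reynolds_map:
  assumes "h \<in> G"
  shows "reynolds (h a) = reynolds a"
proof -
  have "reynolds (h a) = (\<Sum>g\<in>G. (g \<circ> h) a)" by (simp add: reynolds_def)
  also have "\<dots> = (\<Sum>g\<in>G. g a)"
    by (rule sum.reindex_bij_witness[of _ "\<lambda>g. g \<circ> inv_into UNIV h" "\<lambda>g. g \<circ> h"])
       (auto simp: comp_in inv_in assms inv_apply[OF assms] fun_eq_iff)
  finally show ?thesis by (simp add: reynolds_def)
qed

lemma card_G_neq_0: "of_nat (card G) \<noteq> (0::complex)"
  using finite_G id_in by (auto simp: card_gt_0_iff)

lemma fixed_eq_reynolds:
  assumes "\<And>g. g \<in> G \<Longrightarrow> g a = a"
  shows "a = scale_A (1 / of_nat (card G)) (reynolds a)"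
proof -
  have "reynolds a = (\<Sum>g\<in>G. a)"
    unfolding reynolds_def by (rule sum.cong) (simp_all add: assms)
  also have "\<dots> = scale_A (of_nat (card G)) a" by (rule A.sum_constant_scale)
  finally have "reynolds a = scale_A (of_nat (card G)) a" .
  then show ?thesis using card_G_neq_0 by simp
qed

lemma degenerate_iff: "degenerate_orbit G x \<longleftrightarrow> reynolds (laurent_monom x) = 0"
  by (simp add: degenerate_orbit_def reynolds_def)

text \<open>Apply \<open>reynolds\<close> to
  \<open>g (laurent_monom x) = scale_A c (laurent_monom y)\<close> and use that it absorbs
  \<open>g\<close>. Hence degeneracy is constant along an orbit.\<close>

lemma reynolds_monom_orbit:
  assumes "y \<in> orbit_exps x"
  obtains c where "c \<noteq> 0" "reynolds (laurent_monom x) = scale_A c (reynolds (laurent_monom y))"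
  using assms by (elim orbit_expsE) (metis reynolds_map reynolds_scale)

lemma degenerate_orbit_eq: "y \<in> orbit_exps x \<Longrightarrow> degenerate_orbit G x \<longleftrightarrow> degenerate_orbit G y"
  unfolding degenerate_iff by (elim reynolds_monom_orbit) auto

text \<open>Membership in \<open>nondegenerate_orbits\<close> only promises some nondegenerate
  representative of the span; constancy along orbits passes this on to the given
  \<open>x\<close>.\<close>

lemma orbit_span_in_nondegenerate_iff:
  "orbit_span G x \<in> nondegenerate_orbits G \<longleftrightarrow> \<not> degenerate_orbit G x"
  using degenerate_orbit_eq orbit_exps_refl by (auto simp: nondegenerate_orbits_def orbit_span_eq_iff)

lemma orbits_disjoint: "degenerate_orbits G \<inter> nondegenerate_orbits G = {}"
  by (auto simp: degenerate_orbits_def orbit_span_in_nondegenerate_iff)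

lemma reynolds_monom_in: "reynolds (laurent_monom x) \<in> orbit_span G x"
  unfolding reynolds_def orbit_span_def by (intro A.span_sum A.span_base) simp

text \<open>A fixed vector is a multiple of its own average, and the averages of all monomials of
  the orbit are multiples of one vector. The dimension is therefore 1 or 0 according to whether this
  vector is nonzero.\<close>

lemma fixed_points_orbit:
  "fixed_points act_A G (orbit_span G x) = A.span {reynolds (laurent_monom x)}"
proof (intro subset_antisym subsetI)
  fix a assume "a \<in> fixed_points act_A G (orbit_span G x)"
  then have a: "a \<in> orbit_span G x" "\<And>g. g \<in> G \<Longrightarrow> g a = a"
    by (auto simp: fixed_points_def act_A_def)
  have "reynolds (laurent_monom y) \<in> A.span {reynolds (laurent_monom x)}"
    if "y \<in> Poly_Mapping.keys a" for y
  proof -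
    have "x \<in> orbit_exps y"
      using key_orbit_span[OF a(1) that] by (simp add: orbit_span_eq_iff)
    then show ?thesis
      by (elim reynolds_monom_orbit) (auto intro: A.span_scale A.span_base)
  qed
  then have "reynolds a \<in> A.span {reynolds (laurent_monom x)}"
    by (subst reynolds_expand) (intro A.span_sum A.span_scale)
  then show "a \<in> A.span {reynolds (laurent_monom x)}"
    using fixed_eq_reynolds[of a] a(2) by (metis A.span_scale)
next
  fix a assume "a \<in> A.span {reynolds (laurent_monom x)}"
  then obtain c where "a = scale_A c (reynolds (laurent_monom x))" by (auto simp: A.span_singleton)
  then show "a \<in> fixed_points act_A G (orbit_span G x)"
    using reynolds_monom_in[of x]
    by (auto simp: fixed_points_def act_A_def map_scale map_reynolds orbit_span_def intro: A.span_scale)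
qed

text \<open>If the orbit of \<open>y\<close> is degenerate, no average of a monomial has a term at
  \<open>y\<close>: inside the orbit of \<open>y\<close> the averages vanish, outside it their
  supports miss \<open>y\<close>. A fixed vector is a multiple of an average.\<close>

lemma fixed_nondegenerate_key:
  assumes "\<And>g. g \<in> G \<Longrightarrow> g a = a" "y \<in> Poly_Mapping.keys a"
  shows "\<not> degenerate_orbit G y"
proof
  assume y: "degenerate_orbit G y"
  have "Poly_Mapping.lookup (reynolds (laurent_monom x)) y = 0" for x
  proof (cases "y \<in> orbit_exps x")
    case True
    then have "degenerate_orbit G x" using y degenerate_orbit_eq by blast
    then show ?thesis by (simp add: degenerate_iff)
  next
    case False
    then show ?thesis using reynolds_monom_in[of x] by (auto simp: orbit_span_eq in_keys_iff)
  qed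
  then have "Poly_Mapping.lookup (reynolds a) y = 0"
    by (subst reynolds_expand) (simp add: lookup_sum lookup_scale_A)
  then have "Poly_Mapping.lookup a y = 0"
    using fixed_eq_reynolds[of a] assms(1) by (metis lookup_scale_A mult_zero_right)
  then show False using assms(2) by (simp add: in_keys_iff)
qed

lemma has_dim_fixed_nondegenerate:
  assumes "i \<in> nondegenerate_orbits G"
  shows "has_dim scale_A (fixed_points act_A G i) 1"
proof -
  obtain x where "i = orbit_span G x" "reynolds (laurent_monom x) \<noteq> 0"
    using assms by (auto simp: nondegenerate_orbits_def degenerate_iff)
  then show ?thesis
    unfolding has_dim_def fixed_points_orbit
    by (intro exI[of _ "{reynolds (laurent_monom x)}"]) (simp add: fixed_points_orbit)
qed

lemma has_dim_fixed_degenerate: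
  assumes "i \<in> degenerate_orbits G"
  shows "has_dim scale_A (fixed_points act_A G i) 0"
proof -
  obtain x where "i = orbit_span G x" "reynolds (laurent_monom x) = 0"
    using assms by (auto simp: degenerate_orbits_def degenerate_iff)
  then show ?thesis
    unfolding has_dim_def
    by (intro exI[of _ "{}"]) (simp add: fixed_points_orbit A.independent_empty)
qed

section \<open>Free modules and symmetric solutions\<close>

lemma fixed_points_pow_k:
  "v \<in> fixed_points act_Ak G (pow_k i) \<longleftrightarrow> (\<forall>j. v $ j \<in> fixed_points act_A G i)"
  by (auto simp: fixed_points_def act_Ak_def act_A_def pow_k_def vec_eq_iff)

lemma fixed_points_Ak_UNIV:
  "v \<in> fixed_points act_Ak G UNIV \<longleftrightarrow> (\<forall>g\<in>G. \<forall>j. g (v $ j) = v $ j)"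
  by (auto simp: fixed_points_def act_Ak_def vec_eq_iff)

lemma subspace_fixed_points_Ak_UNIV: "Ak.subspace (fixed_points act_Ak G UNIV)"
  by (rule Ak.subspaceI) (auto simp: fixed_points_Ak_UNIV map_0 map_add map_scale scale_Ak_nth)

lemma subspace_fixed_points_pow_k:
  assumes "i \<in> range (orbit_span G)"
  shows "Ak.subspace (fixed_points act_Ak G (pow_k i))"
proof -
  have "A.subspace (fixed_points act_A G i)"
    using assms by (auto simp: fixed_points_orbit)
  then show ?thesis
    by (intro Ak.subspaceI)
       (auto simp: fixed_points_pow_k scale_Ak_nth A.subspace_0 A.subspace_add A.subspace_scale)
qed

definition reynolds_vec :: "'n laurent ^ 'k \<Rightarrow> 'n laurent ^ 'k::finite" where
  "reynolds_vec v = (\<chi> j. reynolds (v $ j))"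

lemma reynolds_vec_0: "reynolds_vec 0 = 0"
  by (simp add: reynolds_vec_def vec_eq_iff reynolds_0)

lemma reynolds_vec_add: "reynolds_vec (v + w) = reynolds_vec v + reynolds_vec w"
  by (simp add: reynolds_vec_def vec_eq_iff reynolds_add)

lemma reynolds_vec_scale: "reynolds_vec (scale_Ak c v) = scale_Ak c (reynolds_vec v)"
  by (simp add: reynolds_vec_def vec_eq_iff reynolds_scale scale_Ak_nth)

lemma reynolds_vec_sum: "reynolds_vec (\<Sum>i\<in>I. v i) = (\<Sum>i\<in>I. reynolds_vec (v i))"
  by (induction I rule: infinite_finite_induct) (simp_all add: reynolds_vec_0 reynolds_vec_add)

lemma reynolds_vec_axis: "reynolds_vec (axis j a) = axis j (reynolds a)"
  by (simp add: reynolds_vec_def axis_def vec_eq_iff reynolds_0)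

lemma fixed_eq_reynolds_vec:
  assumes "v \<in> fixed_points act_Ak G UNIV"
  shows "v = scale_Ak (1 / of_nat (card G)) (reynolds_vec v)"
proof -
  have "v $ j = scale_A (1 / of_nat (card G)) (reynolds (v $ j))" for j
    using assms by (intro fixed_eq_reynolds) (auto simp: fixed_points_Ak_UNIV)
  then show ?thesis by (simp add: vec_eq_iff scale_Ak_nth reynolds_vec_def)
qed

text \<open>A fixed vector is a multiple of its average, hence a combination of averaged monomials
  placed in single coordinates; the degenerate ones among these are \<open>0\<close>. Independence
  is checked coordinate by coordinate.\<close>

lemma direct_sum_fixed:
  "internal_direct_sum scale_Ak (fixed_points act_Ak G (UNIV :: ('n laurent ^ 'k::finite) set))
     (nondegenerate_orbits G) (\<lambda>i. fixed_points act_Ak G (pow_k i))"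
proof -
  have sub: "nondegenerate_orbits G \<subseteq> range (orbit_span G)"
    using orbit_indices by auto
  let ?S = "Ak.span (\<Union>i\<in>nondegenerate_orbits G. fixed_points act_Ak G (pow_k i))
    :: ('n laurent ^ 'k) set"
  show ?thesis unfolding internal_direct_sum_def
  proof (intro conjI ballI allI impI)
    fix i assume "i \<in> nondegenerate_orbits G"
    then show "Ak.subspace (fixed_points act_Ak G (pow_k i))"
      using sub by (intro subspace_fixed_points_pow_k) auto
  next
    have "v \<in> ?S" if v: "v \<in> fixed_points act_Ak G UNIV" for v :: "'n laurent ^ 'k"
    proof -
      have "axis j (reynolds (laurent_monom x)) \<in> ?S" for j x
      proof (cases "degenerate_orbit G x")
        case True
        then have "axis j (reynolds (laurent_monom x)) = (0 :: 'n laurent ^ 'k)"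
          by (simp add: degenerate_iff axis_def vec_eq_iff)
        then show ?thesis by (metis Ak.span_zero)
      next
        case False
        then have "orbit_span G x \<in> nondegenerate_orbits G"
          by (simp add: orbit_span_in_nondegenerate_iff)
        moreover have "axis j (reynolds (laurent_monom x)) \<in>
            (fixed_points act_Ak G (pow_k (orbit_span G x)) :: ('n laurent ^ 'k) set)"
          by (auto simp: fixed_points_pow_k fixed_points_orbit axis_def A.span_zero A.span_base)
        ultimately show ?thesis by (blast intro: Ak.span_base)
      qed
      then have "reynolds_vec v \<in> ?S"
        by (subst laurent_vec_expand[of v])
           (auto simp: reynolds_vec_sum reynolds_vec_scale reynolds_vec_axis
             intro!: Ak.span_sum Ak.span_scale)
      then show ?thesis by (subst fixed_eq_reynolds_vec[OF v]) (rule Ak.span_scale)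
    qed
    moreover have "?S \<subseteq> fixed_points act_Ak G UNIV"
      by (rule Ak.span_minimal[OF _ subspace_fixed_points_Ak_UNIV]) (auto simp: fixed_points_def)
    ultimately show "fixed_points act_Ak G UNIV =
        subspace_sum scale_Ak (nondegenerate_orbits G)
          (\<lambda>i. fixed_points act_Ak G (pow_k i :: ('n laurent ^ 'k) set))"
      unfolding subspace_sum_def by blast
  next
    fix J and v :: "'n laurent set \<Rightarrow> 'n laurent ^ 'k" and i
    assume *: "finite J \<and> J \<subseteq> nondegenerate_orbits G \<and>
      (\<forall>i\<in>J. v i \<in> fixed_points act_Ak G (pow_k i)) \<and> (\<Sum>i\<in>J. v i) = 0" "i \<in> J"
    have "v i $ j = 0" for j
    proof (rule orbit_components_independent[of J "\<lambda>i. v i $ j"])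
      show "(\<Sum>i\<in>J. v i $ j) = 0" using * by (metis sum_component zero_index)
    qed (use * sub in \<open>auto simp: fixed_points_def pow_k_def\<close>)
    then show "v i = 0" by (simp add: vec_eq_iff)
  qed
qed

text \<open>The generator \<open>r\<close> of the fixed line in \<open>i\<close>, placed in each of
  the coordinates in turn, gives the basis.\<close>

lemma has_dim_fixed_pow_k:
  assumes "i \<in> nondegenerate_orbits G"
  shows "has_dim scale_Ak (fixed_points act_Ak G (pow_k i :: ('n laurent ^ 'k::finite) set)) CARD('k)"
proof -
  obtain x where i: "i = orbit_span G x" and nz: "reynolds (laurent_monom x) \<noteq> 0"
    using assms by (auto simp: nondegenerate_orbits_def degenerate_iff)
  define r where "r = reynolds (laurent_monom x)"
  have r: "r \<noteq> 0" using nz by (simp add: r_def)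
  let ?b = "\<lambda>j. axis j r :: 'n laurent ^ 'k"
  have inj: "inj ?b" using r by (auto simp: inj_def axis_eq_axis)
  have comp: "(\<Sum>j\<in>UNIV. scale_Ak (c j) (?b j)) $ l = scale_A (c l) r" for c l
  proof -
    have "scale_Ak (c j) (?b j) $ l = (if j = l then scale_A (c l) r else 0)" for j
      by (simp add: scale_Ak_nth axis_def)
    then show ?thesis by simp
  qed
  have "\<not> Ak.dependent (range ?b)"
  proof (rule Ak.independent_if_scalars_zero)
    fix f v assume f: "(\<Sum>v\<in>range ?b. scale_Ak (f v) v) = 0" and "v \<in> range ?b"
    then obtain l where l: "v = ?b l" by auto
    have "(\<Sum>j\<in>UNIV. scale_Ak (f (?b j)) (?b j)) = 0"
      using f by (simp add: sum.reindex[OF inj])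
    then have "scale_A (f (?b l)) r = 0" using comp[of "\<lambda>j. f (?b j)" l] by simp
    then show "f v = 0" using r l by simp
  qed simp
  moreover have "Ak.span (range ?b) = fixed_points act_Ak G (pow_k i)"
  proof (intro Ak.span_subspace subsetI)
    fix v assume "v \<in> range ?b"
    then show "v \<in> fixed_points act_Ak G (pow_k i)"
      by (auto simp: fixed_points_pow_k i fixed_points_orbit axis_def A.span_zero A.span_base r_def)
  next
    fix v :: "'n laurent ^ 'k" assume "v \<in> fixed_points act_Ak G (pow_k i)"
    then have "\<forall>j. \<exists>c. v $ j = scale_A c r"
      by (auto simp: fixed_points_pow_k i fixed_points_orbit A.span_singleton r_def)
    then obtain c where "\<And>j. v $ j = scale_A (c j) r" by metis
    then have "v = (\<Sum>j\<in>UNIV. scale_Ak (c j) (?b j))" by (simp only: vec_eq_iff comp simp_thms)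
    moreover have "(\<Sum>j\<in>UNIV. scale_Ak (c j) (?b j)) \<in> Ak.span (range ?b)"
      by (intro Ak.span_sum Ak.span_scale Ak.span_base rangeI)
    ultimately show "v \<in> Ak.span (range ?b)" by simp
  qed (auto simp: i intro: subspace_fixed_points_pow_k)
  moreover have "card (range ?b) = CARD('k)" using inj by (rule card_image)
  ultimately show ?thesis unfolding has_dim_def by (intro exI[of _ "range ?b"]) auto
qed

end

section \<open>Orbit projections as truncations of supports\<close>

definition restrict_keys :: "(int ^ 'n::finite) set \<Rightarrow> 'n laurent \<Rightarrow> 'n laurent" where
  "restrict_keys S a =
    (\<Sum>x\<in>Poly_Mapping.keys a \<inter> S. Poly_Mapping.single x (Poly_Mapping.lookup a x))"

lemma lookup_restrict_keys:
  "Poly_Mapping.lookup (restrict_keys S a) x = (if x \<in> S then Poly_Mapping.lookup a x else 0)"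
  by (auto simp: restrict_keys_def lookup_sum lookup_single when_def in_keys_iff)

lemma linear_restrict_keys_vec:
  "Vector_Spaces.linear scale_Ak scale_Ak
     (\<lambda>v :: 'n::finite laurent ^ 'k::finite. \<chi> j. restrict_keys S (v $ j))"
  unfolding Vector_Spaces.linear_iff
  by (auto simp: vec_eq_iff poly_mapping_eq_iff fun_eq_iff lookup_restrict_keys lookup_add scale_Ak_nth
      lookup_scale_A Ak.vector_space_axioms)

text \<open>All exponents occurring in a vector of \<open>pow_k i\<close> have orbit span
  \<open>i\<close>, so the truncation keeps all of its terms or none.\<close>

lemma (in finite_laurent_group) orbit_projection_restrict_keys:
  "orbit_projection G I
     (\<lambda>v :: 'n laurent ^ 'k::finite. \<chi> j. restrict_keys {x. orbit_span G x \<notin> I} (v $ j))"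
  unfolding orbit_projection_def orbit_indices
proof (intro conjI linear_restrict_keys_vec ballI)
  fix i and v :: "'n laurent ^ 'k" assume "i \<in> range (orbit_span G)" and v: "v \<in> pow_k i"
  then obtain x where i: "i = orbit_span G x" by auto
  have key: "orbit_span G y = i" if "y \<in> Poly_Mapping.keys (v $ j)" for y j
    using key_orbit_span[of "v $ j" x y] v that by (simp add: pow_k_def i)
  have "Poly_Mapping.lookup (restrict_keys {x. orbit_span G x \<notin> I} (v $ j)) y =
      Poly_Mapping.lookup ((if i \<in> I then 0 else v) $ j) y" for j y
    using key[of y j] by (auto simp: lookup_restrict_keys in_keys_iff)
  then show "(\<chi> j. restrict_keys {x. orbit_span G x \<notin> I} (v $ j)) = (if i \<in> I then 0 else v)"
    by (simp add: vec_eq_iff poly_mapping_eq_iff fun_eq_iff)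
qed

lemma subspace_of_submodule:
  fixes P :: "('n::finite laurent ^ 'k::finite) set"
  assumes "module.subspace (*s) P"
  shows "Ak.subspace P"
proof (rule Ak.subspaceI)
  fix c and v :: "'n laurent ^ 'k" assume "v \<in> P"
  then have "laurent_const c *s v \<in> P" by (rule laurent_module.subspace_scale[OF assms])
  then show "scale_Ak c v \<in> P"
    by (simp add: scale_Ak_def scale_A_def vector_scalar_mult_def)
qed (use laurent_module.subspace_0[OF assms] laurent_module.subspace_add[OF assms] in auto)

section \<open>The pairing of sequences with the free module, and annihilators\<close>

lemma dual_pairing_add: "dual_pairing f (p + q) = dual_pairing f p + dual_pairing f q"
  by (simp add: dual_pairing_def dual_eval_add sum.distrib)

lemma dual_pairing_0: "dual_pairing f 0 = 0"
  by (simp add: dual_pairing_def dual_eval_0)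

lemma dual_pairing_scale: "dual_pairing f (scale_Ak c q) = c * dual_pairing f q"
  by (simp add: dual_pairing_def dual_eval_scale scale_Ak_nth sum_distrib_left)

lemma dual_pairing_sum: "dual_pairing f (\<Sum>i\<in>I. q i) = (\<Sum>i\<in>I. dual_pairing f (q i))"
  by (induction I rule: infinite_finite_induct) (simp_all add: dual_pairing_add dual_pairing_0)

lemma dual_pairing_0_left: "dual_pairing 0 q = 0"
  by (simp add: dual_pairing_def dual_eval_def)

lemma dual_pairing_add_left: "dual_pairing (f + f') q = dual_pairing f q + dual_pairing f' q"
  by (simp add: dual_pairing_def dual_eval_def sum.distrib algebra_simps)

lemma dual_pairing_scale_left: "dual_pairing (scale_Fk c f) q = c * dual_pairing f q"
  by (simp add: dual_pairing_def dual_eval_def scale_Fk_def sum_distrib_left mult_ac)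

lemma dual_pairing_sum_left: "dual_pairing (\<Sum>i\<in>I. f i) q = (\<Sum>i\<in>I. dual_pairing (f i) q)"
  by (induction I rule: infinite_finite_induct)
     (simp_all add: dual_pairing_add_left dual_pairing_0_left)

lemma dual_pairing_axis: "dual_pairing f (axis j (laurent_monom x)) = (f $ j) x"
proof -
  have "dual_eval (f $ i) (axis j (laurent_monom x) $ i) = (if i = j then (f $ j) x else 0)" for i
    by (simp add: axis_def dual_eval_def)
  then show ?thesis by (simp add: dual_pairing_def)
qed

lemma dual_pairing_inject: "(\<And>q. dual_pairing f q = dual_pairing f' q) \<Longrightarrow> f = f'"
  by (metis dual_pairing_axis vec_eq_iff ext)

text \<open>
  The coordinate functionals of a basis of \<open>A\<^sup>k\<close> extending a basis of \<open>Q\<close>, taken at the additional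
  basis vectors, are linearly independent elements of the annihilator of \<open>Q\<close>.
\<close>

lemma finite_codim_of_finite_dim_annihilator:
  fixes Q :: "('n::finite laurent ^ 'k::finite) set"
  assumes Q: "Ak.subspace Q" and T: "finite T" "{f. \<forall>q\<in>Q. dual_pairing f q = 0} \<subseteq> Fk.span T"
  shows "\<exists>W. finite W \<and> (\<forall>v. \<exists>w\<in>Ak.span W. \<exists>q\<in>Q. v = w + q)"
proof -
  obtain C where C: "C \<subseteq> Q" "\<not> Ak.dependent C" "Q \<subseteq> Ak.span C"
    using Ak.maximal_independent_subset_extend[of "{}" Q] Ak.independent_empty by auto
  obtain B where B: "C \<subseteq> B" "\<not> Ak.dependent B" and "UNIV \<subseteq> Ak.span B"
    using Ak.maximal_independent_subset_extend[OF subset_UNIV C(2)] by metis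
  then have spanB: "v \<in> Ak.span B" for v by auto
  \<comment> \<open>The coordinate functional of \<open>b\<close> with respect to \<open>B\<close>,
    written as a tuple of functions by recording its values on the monomial vectors.\<close>
  define coord :: "'n laurent ^ 'k \<Rightarrow> (int ^ 'n \<Rightarrow> complex) ^ 'k" where
    "coord b = (\<chi> j. (\<lambda>x. Ak.representation B (axis j (laurent_monom x)) b))" for b
  have pairing: "dual_pairing (coord b) q = Ak.representation B q b" for b q
  proof -
    have "dual_pairing (coord b) q = (\<Sum>j\<in>UNIV. \<Sum>x\<in>Poly_Mapping.keys (q $ j).
        Poly_Mapping.lookup (q $ j) x * Ak.representation B (axis j (laurent_monom x)) b)"
      by (subst laurent_vec_expand[of q])
         (simp add: dual_pairing_sum dual_pairing_scale dual_pairing_axis coord_def)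
    also have "\<dots> = Ak.representation B q b"
      by (subst (2) laurent_vec_expand[of q])
         (simp add: Ak.representation_sum[OF B(2) spanB] Ak.representation_scale[OF B(2) spanB])
    finally show ?thesis .
  qed
  have basis: "dual_pairing (coord b) b' = (if b = b' then 1 else 0)" if "b' \<in> B" for b b'
    using that by (simp add: pairing Ak.representation_basis[OF B(2)])
  have inj: "inj_on coord (B - C)"
  proof (rule inj_onI)
    fix b b' assume "b \<in> B - C" "b' \<in> B - C" "coord b = coord b'"
    then have "(if b = b then 1 else 0 :: complex) = (if b' = b then 1 else 0)"
      using basis by (metis DiffD1)
    then show "b = b'" by (simp split: if_splits)
  qed
  have "\<not> Fk.dependent (coord ` (B - C))"
    unfolding Fk.independent_explicit_finite_subsets
  proof (intro allI impI ballI)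
    fix S u f
    assume S: "S \<subseteq> coord ` (B - C)" "finite S" "(\<Sum>v\<in>S. scale_Fk (u v) v) = 0" and f: "f \<in> S"
    obtain b where b: "b \<in> B" "f = coord b" using S(1) f by auto
    have "0 = (\<Sum>v\<in>S. u v * dual_pairing v b)"
      using arg_cong[OF S(3), of "\<lambda>v. dual_pairing v b"]
      by (simp add: dual_pairing_sum_left dual_pairing_scale_left dual_pairing_0_left)
    also have "\<dots> = (\<Sum>v\<in>S. if v = f then u f else 0)"
    proof (rule sum.cong[OF refl])
      fix v assume "v \<in> S"
      then obtain b' where "b' \<in> B" "v = coord b'" using S(1) by auto
      then show "u v * dual_pairing v b = (if v = f then u f else 0)"
        using b basis by (metis mult.right_neutral mult_zero_right)
    qed
    finally show "u f = 0" using S(2) f by simp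
  qed
  moreover have "coord ` (B - C) \<subseteq> Fk.span T"
  proof (rule order_trans[OF _ T(2)], safe)
    fix b q assume b: "b \<in> B" "b \<notin> C" and "q \<in> Q"
    \<comment> \<open>An element of \<open>Q\<close> is already a combination of \<open>C\<close>,
      so its coordinates at basis vectors outside \<open>C\<close> vanish.\<close>
    then have "Ak.representation B q = Ak.representation C q"
      using C(3) by (intro Ak.representation_extend[OF B(2) _ B(1)]) auto
    then show "dual_pairing (coord b) q = 0"
      using b(2) Ak.representation_ne_zero[of C q b] by (auto simp: pairing)
  qed
  ultimately have "finite (coord ` (B - C))"
    using Fk.independent_span_bound[OF T(1)] by blast
  then have "finite (B - C)" using inj by (simp add: finite_image_iff)
  moreover have "\<exists>w\<in>Ak.span (B - C). \<exists>q\<in>Q. v = w + q" for v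
  proof -
    have "B = (B - C) \<union> C" using B(1) by blast
    then have "v \<in> Ak.span ((B - C) \<union> C)" using spanB by metis
    then obtain w q where "v = w + q" "w \<in> Ak.span (B - C)" "q \<in> Ak.span C"
      unfolding Ak.span_Un by blast
    moreover have "Ak.span C \<subseteq> Q" using C(1) Q by (rule Ak.span_minimal)
    ultimately show ?thesis by blast
  qed
  ultimately show ?thesis by blast
qed

section \<open>Finite-dimensional spaces of symmetric solutions\<close>

context finite_laurent_group
begin

lemma reynolds_vec_eq_sum: "reynolds_vec v = (\<Sum>g\<in>G. act_Ak g v)"
  by (simp add: vec_eq_iff reynolds_vec_def reynolds_def act_Ak_def)

lemma reynolds_vec_act: "h \<in> G \<Longrightarrow> reynolds_vec (act_Ak h v) = reynolds_vec v"
  by (simp add: vec_eq_iff reynolds_vec_def act_Ak_def reynolds_map)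

lemma reynolds_vec_invariant:
  assumes "Ak.subspace P" "\<And>g. g \<in> G \<Longrightarrow> act_Ak g ` P = P" "q \<in> P"
  shows "reynolds_vec q \<in> P"
  unfolding reynolds_vec_eq_sum using assms by (intro Ak.subspace_sum) auto

text \<open>Let \<open>Q\<close> be the set of all \<open>q\<close> whose average lies in
  \<open>P\<close>. It contains \<open>P\<close> by invariance, so \<open>f\<close> is a solution;
  it contains every difference of a vector and its translate by \<open>G\<close>, as these average
  to \<open>0\<close>, so \<open>f\<close> is symmetric.\<close>

lemma annihilator_symmetric:
  fixes P :: "('n laurent ^ 'k::finite) set"
  assumes P: "module.subspace (*s) P" "\<And>g. g \<in> G \<Longrightarrow> act_Ak g ` P = P"
    and f: "\<And>q. reynolds_vec q \<in> P \<Longrightarrow> dual_pairing f q = 0"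
  shows "f \<in> fixed_points act_Fk G (ker_F P)"
proof -
  note sub = subspace_of_submodule[OF P(1)]
  have "f \<in> ker_F P"
    using f reynolds_vec_invariant[OF sub P(2)] by (simp add: ker_F_eq_annihilator[OF P(1)])
  moreover have "act_Fk g f = f" if g: "g \<in> G" for g
  proof (rule dual_pairing_inject)
    fix q :: "'n laurent ^ 'k"
    let ?q = "act_Ak (inv_into UNIV g) q"
    have "reynolds_vec (?q - q) = 0"
      using reynolds_vec_act[OF inv_in[OF g], of q] reynolds_vec_add[of "?q - q" q] by simp
    then have "dual_pairing f (?q - q) = 0"
      using f Ak.subspace_0[OF sub] by metis
    then show "dual_pairing (act_Fk g f) q = dual_pairing f q"
      using dual_pairing_add[of f "?q - q" q] by (simp add: dual_pairing_act_Fk[OF aut[OF g]])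
  qed
  ultimately show ?thesis by (simp add: fixed_points_def)
qed

lemma finite_dim_symmetric_solutions:
  fixes P :: "('n laurent ^ 'k::finite) set"
  assumes P: "module.subspace (*s) P" "\<And>g. g \<in> G \<Longrightarrow> act_Ak g ` P = P"
    and fin: "finite_dim scale_Fk (fixed_points act_Fk G (ker_F P))"
  shows "\<exists>I \<subseteq> nondegenerate_orbits G. finite I \<and>
    (\<exists>\<pi>. orbit_projection G I \<pi> \<and>
       subspace_sum scale_Ak ((degenerate_orbits G \<union> nondegenerate_orbits G) - I)
         (\<lambda>i. fixed_points act_Ak G (pow_k i)) \<subseteq> \<pi> ` P)"
proof -
  note sub = subspace_of_submodule[OF P(1)]
  obtain T where T: "finite T" "Fk.span T = fixed_points act_Fk G (ker_F P)"
    using fin by (auto simp: finite_dim_def has_dim_def)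
  define Q where "Q = {q. reynolds_vec q \<in> P}"
  have Q: "Ak.subspace Q"
    using sub by (intro Ak.subspaceI)
      (auto simp: Q_def reynolds_vec_0 reynolds_vec_add reynolds_vec_scale
        Ak.subspace_0 Ak.subspace_add Ak.subspace_scale)
  have "{f. \<forall>q\<in>Q. dual_pairing f q = 0} \<subseteq> Fk.span T"
    unfolding T(2) using annihilator_symmetric[OF P] by (auto simp: Q_def)
  from finite_codim_of_finite_dim_annihilator[OF Q T(1) this]
  obtain W where W: "finite W" "\<And>v. \<exists>w\<in>Ak.span W. \<exists>q\<in>Q. v = w + q" by blast
  \<comment> \<open>All exponents occurring in averages of the finitely many representatives
    \<open>W\<close> modulo \<open>Q\<close>. These averages are fixed, so the orbits through
    \<open>K\<close> are nondegenerate.\<close>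
  define K where "K = (\<Union>w\<in>W. \<Union>j. Poly_Mapping.keys (reynolds_vec w $ j))"
  define I where "I = orbit_span G ` K"
  have fixedW: "g (reynolds_vec w $ j) = reynolds_vec w $ j" if "g \<in> G" for g w and j :: 'k
    using that by (simp add: reynolds_vec_def map_reynolds)
  have "I \<subseteq> nondegenerate_orbits G"
    unfolding I_def K_def using fixed_nondegenerate_key fixedW
    by (fastforce simp: orbit_span_in_nondegenerate_iff)
  moreover have "finite I" using W(1) by (simp add: I_def K_def)
  moreover define \<pi> :: "'n laurent ^ 'k \<Rightarrow> 'n laurent ^ 'k"
    where "\<pi> v = (\<chi> j. restrict_keys {x. orbit_span G x \<notin> I} (v $ j))" for v
  have proj: "orbit_projection G I \<pi>"
    using orbit_projection_restrict_keys unfolding \<pi>_def .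
  have lin: "\<pi> (v + w) = \<pi> v + \<pi> w" "\<pi> (scale_Ak c v) = scale_Ak c (\<pi> v)" for v w c
    using proj unfolding orbit_projection_def Vector_Spaces.linear_iff by auto
  have pi0: "\<pi> 0 = 0" using lin(2)[of 0 0] by simp
  \<comment> \<open>For \<open>w\<close> in \<open>W\<close> the average is supported on
    \<open>K\<close>, whose orbits are exactly those removed by \<pi>; linearity extends this to the
    span.\<close>
  have pi_R: "\<pi> (reynolds_vec w) = 0" if "w \<in> Ak.span W" for w
    using that
  proof (induction rule: Ak.span_induct_alt)
    case (step c w y)
    have "Poly_Mapping.lookup (\<pi> (reynolds_vec w) $ j) x = 0" for j x
    proof (cases "x \<in> K")
      case True
      then show ?thesis by (simp add: \<pi>_def lookup_restrict_keys I_def)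
    next
      case False
      then have "Poly_Mapping.lookup (reynolds_vec w $ j) x = 0"
        using step(1) by (auto simp: K_def in_keys_iff)
      then show ?thesis by (simp add: \<pi>_def lookup_restrict_keys)
    qed
    then have "\<pi> (reynolds_vec w) = 0"
      by (simp add: vec_eq_iff poly_mapping_eq_iff fun_eq_iff)
    then show ?case using step(2) by (simp add: reynolds_vec_add reynolds_vec_scale lin)
  qed (simp add: reynolds_vec_0 pi0)
  have "v \<in> \<pi> ` P"
    if "v \<in> subspace_sum scale_Ak ((degenerate_orbits G \<union> nondegenerate_orbits G) - I)
      (\<lambda>i. fixed_points act_Ak G (pow_k i))" for v
  proof -
    have fixed_and_proj: "v \<in> fixed_points act_Ak G UNIV \<and> \<pi> v = v"
      using that unfolding subspace_sum_def
    proof (induction rule: Ak.span_induct_alt)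
      case base
      then show ?case using Ak.subspace_0[OF subspace_fixed_points_Ak_UNIV] pi0 by simp
    next
      case (step c x y)
      then obtain i where i: "i \<in> degenerate_orbits G \<union> nondegenerate_orbits G" "i \<notin> I"
        "x \<in> fixed_points act_Ak G (pow_k i)" by blast
      then have "\<pi> x = x" "x \<in> fixed_points act_Ak G UNIV"
        using proj unfolding orbit_projection_def by (auto simp: fixed_points_def)
      then show ?case using step(2)
        by (simp add: lin Ak.subspace_add Ak.subspace_scale subspace_fixed_points_Ak_UNIV)
    qed
    obtain w q where wq: "w \<in> Ak.span W" "q \<in> Q" "v = w + q" using W(2)[of v] by blast
    let ?p = "scale_Ak (1 / of_nat (card G)) (reynolds_vec q)"
    \<comment> \<open>As \<open>v\<close> is fixed, it is its own normalised average, and \<pi>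
      leaves it unchanged. Splitting \<open>v = w + q\<close> inside the average, \<pi> kills the
      part from \<open>w\<close>, and the part from \<open>q\<close> lies in \<open>P\<close> by
      definition of \<open>Q\<close>.\<close>
    have "v = \<pi> (scale_Ak (1 / of_nat (card G)) (reynolds_vec v))"
      using fixed_and_proj fixed_eq_reynolds_vec[of v] by simp
    also have "\<dots> = \<pi> ?p"
      using pi_R[OF wq(1)] by (simp add: wq(3) reynolds_vec_add lin)
    finally have "v = \<pi> ?p" .
    moreover have "?p \<in> P" using wq(2) sub by (auto simp: Q_def intro: Ak.subspace_scale)
    ultimately show ?thesis by blast
  qed
  ultimately show ?thesis using proj by blast
qed

end

theorem theorem4p2:
  fixes G :: "('n::finite laurent \<Rightarrow> 'n laurent) set"
  assumes "subgroup G laurent_AutGroup" and "finite G"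
  shows
    "degenerate_orbits G \<inter> nondegenerate_orbits G = {} \<and>
     (\<forall>i \<in> degenerate_orbits G \<union> nondegenerate_orbits G. \<forall>g\<in>G. act_A g ` i = i) \<and>
     internal_direct_sum scale_A UNIV
       (degenerate_orbits G \<union> nondegenerate_orbits G) (\<lambda>i. i) \<and>
     (\<forall>i \<in> nondegenerate_orbits G. has_dim scale_A (fixed_points act_A G i) 1) \<and>
     (\<forall>i \<in> degenerate_orbits G. has_dim scale_A (fixed_points act_A G i) 0) \<and>
     internal_direct_sum scale_Ak
       (fixed_points act_Ak G (UNIV :: ('n laurent ^ 'k::finite) set))
       (nondegenerate_orbits G) (\<lambda>i. fixed_points act_Ak G (pow_k i)) \<and>
     (\<forall>i \<in> nondegenerate_orbits G.
        has_dim scale_Ak (fixed_points act_Ak G (pow_k i :: ('n laurent ^ 'k) set)) CARD('k)) \<and>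
     (\<forall>P :: ('n laurent ^ 'k) set.
        module.subspace (*s) P \<and> (\<forall>g\<in>G. act_Ak g ` P = P) \<longrightarrow>
        \<not> (quot_finite_dim scale_Ak P \<or>
           (\<exists>I \<subseteq> nondegenerate_orbits G. finite I \<and>
              (\<exists>\<pi>. orbit_projection G I \<pi> \<and>
                 subspace_sum scale_Ak ((degenerate_orbits G \<union> nondegenerate_orbits G) - I)
                   (\<lambda>i. fixed_points act_Ak G (pow_k i)) \<subseteq> \<pi> ` P))) \<longrightarrow>
        \<not> finite_dim scale_Fk (fixed_points act_Fk G (ker_F P)))"
proof -
  interpret finite_laurent_group G using assms by (rule finite_laurent_group.intro)
  show ?thesis
  proof (intro conjI ballI allI impI)
    fix i g assume "i \<in> degenerate_orbits G \<union> nondegenerate_orbits G" "g \<in> G"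
    moreover have "act_A g = g" by (rule ext) (simp add: act_A_def)
    ultimately show "act_A g ` i = i" unfolding orbit_indices using image_orbit_span by force
  next
    fix P :: "('n laurent ^ 'k) set"
    assume "module.subspace (*s) P \<and> (\<forall>g\<in>G. act_Ak g ` P = P)"
    then have P: "module.subspace (*s) P" "\<And>g. g \<in> G \<Longrightarrow> act_Ak g ` P = P" by auto
    assume no: "\<not> (quot_finite_dim scale_Ak P \<or>
      (\<exists>I \<subseteq> nondegenerate_orbits G. finite I \<and>
         (\<exists>\<pi>. orbit_projection G I \<pi> \<and>
            subspace_sum scale_Ak ((degenerate_orbits G \<union> nondegenerate_orbits G) - I)
              (\<lambda>i. fixed_points act_Ak G (pow_k i)) \<subseteq> \<pi> ` P)))"
    show "\<not> finite_dim scale_Fk (fixed_points act_Fk G (ker_F P))"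
    proof
      assume "finite_dim scale_Fk (fixed_points act_Fk G (ker_F P))"
      with P have "\<exists>I \<subseteq> nondegenerate_orbits G. finite I \<and>
         (\<exists>\<pi>. orbit_projection G I \<pi> \<and>
            subspace_sum scale_Ak ((degenerate_orbits G \<union> nondegenerate_orbits G) - I)
              (\<lambda>i. fixed_points act_Ak G (pow_k i)) \<subseteq> \<pi> ` P)"
        by (rule finite_dim_symmetric_solutions)
      with no show False by simp
    qed
  qed (fact orbits_disjoint direct_sum_orbits has_dim_fixed_nondegenerate has_dim_fixed_degenerate
      direct_sum_fixed has_dim_fixed_pow_k)+
qed

end
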